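(* Let $b>0$ and $\sigma\ge b$. Let the source model be the Laplace location model $X_\theta\sim\mathsf{Lap}(\theta,b)$ and the target model be $v(\cdot;\theta)=$ the density of $\mathcal{N}(\theta,\sigma^2)$. Let $\mathcal{P}(\cdot|x)$ be the density of $\mathcal{N}(x,\sigma^2)$ for each $x\in\mathbb{R}$ and let $$\mathcal{S}^*(y|x)=\big(v(y;\theta)-b^2\nabla^{(2)}_\theta v(y;\theta)\big)\big|_{\theta=x}.$$ Then for each $\epsilon\in(0,1)$ and $\theta\in\mathbb{R}$, Algorithm $\textsc{rk}$ using $\mathcal{S}^*$ and $\mathcal{P}$, with $M=2$, $N\ge2\log(4/\epsilon)$ and any $y_0\in\mathbb{R}$, satisfies $$\big\|\mathcal{L}[\textsc{rk}(X_\theta,N,M,y_0)]-\mathcal{N}(\theta,\sigma^2)\big\|_{\mathsf{TV}}\le\frac{\epsilon}{2}+6\exp\Big\{-\frac{\sigma^2}{2b^2}\Big\}.$$ Consequently, for any $\Theta\subseteq\mathbb{R}$, provided $\sigma^2\ge2b^2\log(12/\epsilon)$, the algorithm $\textsc{rk}$ (with $N=2\log(4/\epsilon)$) runs in time $O(\log(4/\epsilon)(T_{samp}+T_{eval}))$ and satisfies $$\sup_{\theta\in\Theta}\big\|\mathcal{L}[\textsc{rk}(X_\theta,N,M,y_0)]-\mathcal{N}(\theta,\sigma^2)\big\|_{\mathsf{TV}}\le\epsilon .$$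
   Context: $\mathsf{Lap}(\theta,b)$ has density $\frac{1}{2b}e^{-|x-\theta|/b}$ on $\mathbb{R}$. $\nabla^{(2)}_\theta$ is the second derivative in $\theta$. $\mathcal{L}[\cdot]$ denotes the law, $\|\cdot\|_{\mathsf{TV}}$ total variation distance, $\log$ is natural. Algorithm $\textsc{rk}(x,N,M,y_0)$ with kernel $\mathcal{S}^*$ and base densities $\mathcal{P}$: set $t=0$, $Y=y_0$, marked "unset". Repeat until $Y$ is set or $t\ge N+1$: draw $U_t\sim\mathsf{Unif}([0,1])$ and $Y_t\sim\mathcal{P}(\cdot|x)$, independent of each other and of the past; if $U_t\le\frac{\mathcal{S}^*(Y_t|x)\vee0}{M\,\mathcal{P}(Y_t|x)}$, set $Y\leftarrow Y_t$; then $t\leftarrow t+1$. Output $Y$. On a random input $X_\theta$, it is run with $x=X_\theta$ and fresh independent randomness. Running time: $T_{samp}$ per sample from $\mathcal{P}(\cdot|x)$, $T_{eval}$ per evaluation of $\mathcal{S}^*$, $O(1)$ for other operations per iteration. *)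

theory Defs
  imports "HOL-Probability.Probability"
begin

definition laplace_density :: "real \<Rightarrow> real \<Rightarrow> real \<Rightarrow> real" where
  "laplace_density \<theta> b x = 1 / (2 * b) * exp (- \<bar>x - \<theta>\<bar> / b)"

definition laplace_measure :: "real \<Rightarrow> real \<Rightarrow> real measure" where
  "laplace_measure \<theta> b = density lborel (\<lambda>x. ennreal (laplace_density \<theta> b x))"

definition normal_measure :: "real \<Rightarrow> real \<Rightarrow> real measure" where
  "normal_measure \<mu> \<sigma> = density lborel (\<lambda>x. ennreal (normal_density \<mu> \<sigma> x))"

text \<open>The second argument of \<^const>\<open>normal_density\<close> is the standard deviation. A model
  density is written \<open>v y \<theta>\<close> and a conditional density \<open>P y x\<close>, following
  \<open>v(y; \<theta>)\<close> and \<open>P(y | x)\<close>.\<close>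

definition normal_model :: "real \<Rightarrow> real \<Rightarrow> real \<Rightarrow> real" where
  "normal_model \<sigma> y \<theta> = normal_density \<theta> \<sigma> y"

definition signed_kernel :: "real \<Rightarrow> (real \<Rightarrow> real \<Rightarrow> real) \<Rightarrow> real \<Rightarrow> real \<Rightarrow> real" where
  "signed_kernel b v y x = v y x - b\<^sup>2 * (deriv ^^ 2) (\<lambda>\<theta>. v y \<theta>) x"

text \<open>Total variation distance of two probability measures on the same \<open>\<sigma>\<close>-algebra,
  normalised to take values in \<open>[0, 1]\<close>.\<close>

definition tv_dist :: "'a measure \<Rightarrow> 'a measure \<Rightarrow> real" where
  "tv_dist \<mu> \<nu> = (SUP A\<in>sets \<mu>. \<bar>measure \<mu> A - measure \<nu> A\<bar>)"

text \<open>The joint law of the final values of \<open>Y\<close> and of the iteration counter \<open>t\<close>, for the loop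
  started in state \<open>(t, Y, unset)\<close>. The bound \<open>N\<close> is real, so that at most
  \<open>\<lceil>N\<rceil> + 1\<close> iterations are made from \<open>t = 0\<close>.\<close>

function rk_loop ::
  "(real \<Rightarrow> real \<Rightarrow> real) \<Rightarrow> (real \<Rightarrow> real \<Rightarrow> real) \<Rightarrow> real \<Rightarrow> real \<Rightarrow> real \<Rightarrow>
    nat \<Rightarrow> real \<Rightarrow> bool \<Rightarrow> (real \<times> nat) measure" where
  "rk_loop S P x N M t Y unset =
    (if \<not> unset \<or> real t \<ge> N + 1
     then return (borel \<Otimes>\<^sub>M count_space UNIV) (Y, t)
     else do {
       U\<^sub>t \<leftarrow> uniform_measure lborel {0..1::real};
       Y\<^sub>t \<leftarrow> density lborel (\<lambda>y. ennreal (P y x));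
       if U\<^sub>t \<le> max (S Y\<^sub>t x) 0 / (M * P Y\<^sub>t x)
       then rk_loop S P x N M (t + 1) Y\<^sub>t False
       else rk_loop S P x N M (t + 1) Y True
     })"
  by pat_completeness auto
termination
  by (relation "Wellfounded.measure (\<lambda>(S, P, x, N, M, t, Y, unset). nat \<lceil>N + 1 - real t\<rceil>)") (auto, linarith+)

declare rk_loop.simps [simp del]

definition rk_run ::
  "(real \<Rightarrow> real \<Rightarrow> real) \<Rightarrow> (real \<Rightarrow> real \<Rightarrow> real) \<Rightarrow> real \<Rightarrow> real \<Rightarrow> real \<Rightarrow> real \<Rightarrow>
    (real \<times> nat) measure" where
  "rk_run S P x N M y\<^sub>0 = rk_loop S P x N M 0 y\<^sub>0 True"

definition rk ::
  "(real \<Rightarrow> real \<Rightarrow> real) \<Rightarrow> (real \<Rightarrow> real \<Rightarrow> real) \<Rightarrow> real \<Rightarrow> real \<Rightarrow> real \<Rightarrow> real \<Rightarrow> real measure" where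
  "rk S P x N M y\<^sub>0 = distr (rk_run S P x N M y\<^sub>0) borel fst"

text \<open>Every iteration draws one sample from \<open>P(\<cdot> | x)\<close>, evaluates \<open>S\<close> once, and spends
  time \<open>c\<close> on everything else.\<close>

definition rk_time :: "real \<Rightarrow> real \<Rightarrow> real \<Rightarrow> nat \<Rightarrow> real" where
  "rk_time T_samp T_eval c t = real t * (T_samp + T_eval + c)"

definition rk_laplace_normal :: "real \<Rightarrow> real \<Rightarrow> real \<Rightarrow> real \<Rightarrow> real \<Rightarrow> real \<Rightarrow> real measure" where
  "rk_laplace_normal b \<sigma> \<theta> N M y\<^sub>0 =
    laplace_measure \<theta> b \<bind>
      (\<lambda>x. rk (signed_kernel b (normal_model \<sigma>)) (\<lambda>y x. normal_density x \<sigma> y) x N M y\<^sub>0)"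

end

theory Submission
  imports Defs "HOL-Real_Asymp.Real_Asymp"
begin

text \<open>Three estimates combine. The Laplace density is the Green's function of
  \<open>1 - b\<^sup>2 d\<^sup>2/dx\<^sup>2\<close>, so integrating the signed kernel \<open>S\<close> against it returns the
  target density exactly. Write \<open>S\<^sup>+\<close>, \<open>S\<^sup>-\<close> for the positive and negative parts of
  \<open>S\<close> and \<open>q = \<integral>S\<^sup>-\<close>, so \<open>\<integral>S\<^sup>+ = 1 + q\<close>. One iteration accepts with probability
  \<open>p = (1 + q) / 2 \<ge> 1/2\<close>, hence the output law given \<open>x\<close> is within \<open>(1 - p)\<^sup>k\<close> of
  \<open>S\<^sup>+ / (1 + q)\<close> after \<open>k\<close> iterations, and the latter is within \<open>q\<close> of \<open>S\<close>. Finally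
  \<open>q\<close> is a Gaussian tail: an exponential Markov bound dominates \<open>S\<^sup>-\<close> pointwise by
  \<open>6 exp (- \<sigma>\<^sup>2 / (2 b\<^sup>2))\<close> times a wider normal density.\<close>

section \<open>Auxiliary facts: kernels given by densities, and a uniform threshold test\<close>

text \<open>By Tonelli, the mass of a fixed set is a parameter integral of a jointly measurable
  function, hence measurable in the parameter.\<close>

lemma density_measurable_prob_algebra:
  assumes [measurable]: "case_prod p \<in> borel_measurable (M \<Otimes>\<^sub>M L)"
    and "sigma_finite_measure L"
    and "\<And>x. x \<in> space M \<Longrightarrow> prob_space (density L (p x))"
    and K: "sets K = sets L"
  shows "(\<lambda>x. density L (p x)) \<in> M \<rightarrow>\<^sub>M prob_algebra K"
proof (rule measurable_prob_algebraI[OF assms(3)])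
  interpret L: sigma_finite_measure L by fact
  show "(\<lambda>x. density L (p x)) \<in> M \<rightarrow>\<^sub>M subprob_algebra K"
  proof (rule measurable_subprob_algebra)
    fix x assume "x \<in> space M"
    then show "subprob_space (density L (p x))"
      using assms(3) prob_space_imp_subprob_space by blast
  next
    fix A assume "A \<in> sets K"
    then have [measurable]: "A \<in> sets L" by (simp add: K)
    have "(\<lambda>x. \<integral>\<^sup>+y. p x y * indicator A y \<partial>L) \<in> borel_measurable M"
      by measurable
    also have "?this \<longleftrightarrow> (\<lambda>x. emeasure (density L (p x)) A) \<in> borel_measurable M"
      by (intro measurable_cong) (simp add: emeasure_density)
    finally show "(\<lambda>x. emeasure (density L (p x)) A) \<in> borel_measurable M" .
  qed (simp add: K)
qed

text \<open>Integrates out the acceptance test: \<open>\<alpha>\<close> is the value after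
  acceptance, \<open>\<beta>\<close> the value after rejection, and \<open>r\<close> in [0, 1] is
  the acceptance probability.\<close>

lemma nn_integral_uniform_threshold:
  fixes r :: real
  assumes "0 \<le> r" "r \<le> 1" "0 \<le> \<alpha>" "0 \<le> \<beta>"
  shows "(\<integral>\<^sup>+u. ennreal (if u \<le> r then \<alpha> else \<beta>) \<partial>uniform_measure lborel {0..1})
    = ennreal (r * \<alpha> + (1 - r) * \<beta>)"
proof -
  have *: "{0..1} \<inter> {..r} = {0..r}" "{0..1} \<inter> {r<..} = {r<..1}"
    using assms by auto
  have "(\<integral>\<^sup>+u. ennreal (if u \<le> r then \<alpha> else \<beta>) \<partial>uniform_measure lborel {0..1})
    = (\<integral>\<^sup>+u. ennreal \<alpha> * indicator {..r} u + ennreal \<beta> * indicator {r<..} u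
        \<partial>uniform_measure lborel {0..1})"
    by (intro nn_integral_cong) (auto simp: indicator_def)
  also have "\<dots> = ennreal \<alpha> * ennreal r + ennreal \<beta> * ennreal (1 - r)"
    using assms by (subst nn_integral_add)
      (auto simp: nn_integral_cmult emeasure_uniform_measure * divide_ennreal_def)
  also have "\<dots> = ennreal (r * \<alpha> + (1 - r) * \<beta>)"
    using assms by (simp add: ennreal_mult'[symmetric] ennreal_plus[symmetric] mult.commute
        del: ennreal_plus)
  finally show ?thesis .
qed

section \<open>Rejection sampling with a signed kernel\<close>

text \<open>\<open>S_le\<close> keeps the acceptance ratio at most 1, so it is a genuine
  probability; \<open>P_pos\<close> allows the proposal density to cancel against its
  denominator.\<close>

locale rejection_kernel =
  fixes S P :: "real \<Rightarrow> real \<Rightarrow> real" and N M :: real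
  assumes S_measurable [measurable]: "case_prod S \<in> borel_measurable (borel \<Otimes>\<^sub>M borel)"
    and P_measurable [measurable]: "case_prod P \<in> borel_measurable (borel \<Otimes>\<^sub>M borel)"
    and P_pos: "\<And>y x. P y x > 0"
    and P_prob: "\<And>x. prob_space (density lborel (\<lambda>y. ennreal (P y x)))"
    and M_pos: "M > 0"
    and S_le: "\<And>y x. S y x \<le> M * P y x"
begin

abbreviation out :: "(real \<times> nat) measure" where
  "out \<equiv> borel \<Otimes>\<^sub>M count_space UNIV"

section \<open>Measurability of the sampling loop in the input and the current value\<close>

lemma P_kernel [measurable]:
  "(\<lambda>x. density lborel (\<lambda>y. ennreal (P y x))) \<in> borel \<rightarrow>\<^sub>M prob_algebra borel"
  by (intro density_measurable_prob_algebra P_prob sigma_finite_lborel) measurable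

lemma uniform_kernel [measurable]:
  "uniform_measure lborel {0..1::real} \<in> space (prob_algebra borel)"
  by (auto simp: space_prob_algebra intro!: prob_space_uniform_measure)

lemma S_measurable' [measurable (raw)]:
  "f \<in> borel_measurable L \<Longrightarrow> g \<in> borel_measurable L \<Longrightarrow> (\<lambda>z. S (f z) (g z)) \<in> borel_measurable L"
  using measurable_compose[OF measurable_Pair S_measurable, of f L g] by simp

lemma P_measurable' [measurable (raw)]:
  "f \<in> borel_measurable L \<Longrightarrow> g \<in> borel_measurable L \<Longrightarrow> (\<lambda>z. P (f z) (g z)) \<in> borel_measurable L"
  using measurable_compose[OF measurable_Pair P_measurable, of f L g] by simp

text \<open>The nesting of the pairs follows the order of the draws: each monadic bind extends the
  state by one component on the right, so the measurability rule for bind applies twice.\<close>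

definition rk_step :: "nat \<Rightarrow> ((real \<times> real) \<times> real) \<times> real \<Rightarrow> (real \<times> nat) measure" where
  "rk_step t = (\<lambda>(((x, Y), U), y). if U \<le> max (S y x) 0 / (M * P y x)
     then rk_loop S P x N M (t + 1) y False else rk_loop S P x N M (t + 1) Y True)"

lemma rk_loop_bind:
  assumes "real t < N + 1"
  shows "rk_loop S P x N M t Y True = uniform_measure lborel {0..1} \<bind>
    (\<lambda>U. density lborel (\<lambda>y. ennreal (P y x)) \<bind> (\<lambda>y. rk_step t (((x, Y), U), y)))"
  using assms by (subst rk_loop.simps) (simp add: rk_step_def)

text \<open>Measurability of the remaining loop is a hypothesis here, so that the lemma can serve
  inside the induction that establishes it.\<close>

lemma rk_step_measurable_aux:
  assumes loop: "\<And>u. (\<lambda>(x, Y). rk_loop S P x N M (t + 1) Y u) \<in> borel \<Otimes>\<^sub>M borel \<rightarrow>\<^sub>M prob_algebra out"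
  shows "rk_step t \<in> ((borel \<Otimes>\<^sub>M borel) \<Otimes>\<^sub>M borel) \<Otimes>\<^sub>M borel \<rightarrow>\<^sub>M prob_algebra out"
proof -
  have [measurable]: "(\<lambda>z. rk_loop S P (f z) N M (t + 1) (g z) u) \<in> L \<rightarrow>\<^sub>M prob_algebra out"
    if "f \<in> borel_measurable L" "g \<in> borel_measurable L" for f g u and L :: "'z measure"
    using measurable_compose[OF measurable_Pair[OF that] loop] by simp
  show ?thesis
    unfolding rk_step_def split_beta'
    by (intro measurable_If) measurable
qed

text \<open>Induction on the number of iterations left. Measurability is joint in \<open>x\<close>
  and \<open>Y\<close>, since an accepted draw becomes the new \<open>Y\<close> and \<open>x\<close>
  is itself random later.\<close>

lemma rk_loop_measurable:
  "(\<lambda>(x, Y). rk_loop S P x N M t Y u) \<in> borel \<Otimes>\<^sub>M borel \<rightarrow>\<^sub>M prob_algebra out"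
proof (induction "nat \<lceil>N + 1 - real t\<rceil>" arbitrary: t u rule: less_induct)
  case less
  show ?case
  proof (cases "\<not> u \<or> real t \<ge> N + 1")
    case True
    then show ?thesis by (subst rk_loop.simps) simp
  next
    case False
    have "(\<lambda>(x, Y). rk_loop S P x N M (t + 1) Y u) \<in> borel \<Otimes>\<^sub>M borel \<rightarrow>\<^sub>M
      prob_algebra out" for u
      by (rule less) (use False in linarith)
    then have [measurable]:
      "rk_step t \<in> ((borel \<Otimes>\<^sub>M borel) \<Otimes>\<^sub>M borel) \<Otimes>\<^sub>M borel \<rightarrow>\<^sub>M prob_algebra out"
      by (rule rk_step_measurable_aux)
    have "(\<lambda>z. uniform_measure lborel {0..1::real} \<bind> (\<lambda>U.
         density lborel (\<lambda>y. ennreal (P y (fst z))) \<bind> (\<lambda>y. rk_step t ((z, U), y))))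
      \<in> borel \<Otimes>\<^sub>M borel \<rightarrow>\<^sub>M prob_algebra out"
      by (intro measurable_bind_prob_space2[OF measurable_const[OF uniform_kernel]]
          measurable_bind_prob_space2[where N=borel] | unfold split_beta', measurable)+
    also have "?this \<longleftrightarrow> ?thesis"
      using False by (simp add: rk_loop_bind split_beta')
    finally show ?thesis .
  qed
qed

lemma rk_step_measurable [measurable]:
  "rk_step t \<in> ((borel \<Otimes>\<^sub>M borel) \<Otimes>\<^sub>M borel) \<Otimes>\<^sub>M borel \<rightarrow>\<^sub>M prob_algebra out"
  by (rule rk_step_measurable_aux) (rule rk_loop_measurable)

lemma measure_rk_loop_set: "measure (rk_loop S P x N M t Y False) (A \<times> UNIV) = indicator A Y"
  if "A \<in> sets borel"
  using that by (subst rk_loop.simps) (simp add: measure_return indicator_def)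

section \<open>Acceptance probabilities and geometric convergence\<close>

text \<open>This is the probability that one iteration accepts a draw lying in \<open>A\<close>: the
  proposal density has been cancelled against the denominator of the acceptance ratio.\<close>

definition accept :: "real \<Rightarrow> real set \<Rightarrow> real" where
  "accept x A = (\<integral>y. indicator A y * (max (S y x) 0 / M) \<partial>lborel)"

lemma P_integrable: "integrable lborel (\<lambda>y. P y x)" and P_integral: "(\<integral>y. P y x \<partial>lborel) = 1"
proof -
  have "(\<integral>\<^sup>+y. ennreal (P y x) \<partial>lborel) = 1"
    using prob_space.emeasure_space_1[OF P_prob[of x]] by (simp add: emeasure_density)
  then have "has_bochner_integral lborel (\<lambda>y. P y x) 1"
    by (intro has_bochner_integral_nn_integral) (auto intro: less_imp_le P_pos)
  then show "integrable lborel (\<lambda>y. P y x)" "(\<integral>y. P y x \<partial>lborel) = 1"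
    by (auto simp: has_bochner_integral_iff)
qed

lemma density_accept: "max (S y x) 0 / M \<le> P y x"
  using S_le[of y x] M_pos P_pos[of y x] by (simp add: field_simps)

lemma accept_integrable:
  assumes [measurable]: "A \<in> sets borel"
  shows "integrable lborel (\<lambda>y. indicator A y * (max (S y x) 0 / M))"
  using density_accept[of _ x] M_pos
  by (intro Bochner_Integration.integrable_bound[OF P_integrable[of x]] AE_I2)
    (auto simp: indicator_def abs_of_pos P_pos less_imp_le)

lemma accept_mono: "A \<in> sets borel \<Longrightarrow> accept x A \<le> accept x UNIV"
  unfolding accept_def using M_pos
  by (intro integral_mono accept_integrable) (auto simp: indicator_def)

lemma accept_nonneg: "0 \<le> accept x A"
  unfolding accept_def using M_pos by (intro integral_nonneg_AE) auto

lemma accept_le_1: "accept x UNIV \<le> 1"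
  unfolding accept_def P_integral[of x, symmetric]
  using accept_integrable[of UNIV x] density_accept
  by (intro integral_mono) (auto simp: P_integrable)

lemma rk_loop_kernel: "rk_loop S P x N M t Y u \<in> space (prob_algebra out)"
  using measurable_space[OF rk_loop_measurable, of "(x, Y)"] by (simp add: space_pair_measure)

text \<open>First-step analysis: an accepted draw is final and counts if it lies in
  \<open>A\<close>; otherwise, with probability \<open>1 - accept x UNIV\<close>, the loop goes on
  with \<open>Y\<close> unchanged.\<close>

lemma measure_rk_loop_step:
  assumes t: "real t < N + 1" and A [measurable]: "A \<in> sets borel"
  shows "measure (rk_loop S P x N M t Y True) (A \<times> UNIV)
    = accept x A + (1 - accept x UNIV) * measure (rk_loop S P x N M (t + 1) Y True) (A \<times> UNIV)"
proof -
  define \<beta> where "\<beta> = measure (rk_loop S P x N M (t + 1) Y True) (A \<times> UNIV)"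
  define U where "U = uniform_measure lborel {0..1::real}"
  define D where "D = density lborel (\<lambda>y. ennreal (P y x))"
  define f where "f = (\<lambda>z. rk_step t (((x, Y), fst z), snd z))"
  have f [measurable]: "f \<in> borel \<Otimes>\<^sub>M borel \<rightarrow>\<^sub>M prob_algebra out"
    unfolding f_def by measurable
  have D: "D \<in> space (prob_algebra borel)" and U: "U \<in> space (prob_algebra borel)"
    using P_prob[of x] unfolding D_def U_def by (auto simp: space_prob_algebra intro!: prob_space_uniform_measure)
  then have [measurable_cong]: "sets D = sets borel" "sets U = sets borel"
    by (simp_all add: space_prob_algebra)
  interpret D: prob_space D using D by (simp add: space_prob_algebra)
  interpret U: prob_space U using U by (simp add: space_prob_algebra)
  interpret UD: pair_sigma_finite U D ..
  have \<beta>: "0 \<le> \<beta>" by (simp add: \<beta>_def)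
  have B [measurable]: "A \<times> UNIV \<in> sets out" by simp
  have inner: "emeasure (f (u, y)) (A \<times> UNIV) =
      ennreal (if u \<le> max (S y x) 0 / (M * P y x) then indicator A y else \<beta>)" for u y
  proof -
    interpret F: prob_space "rk_loop S P x N M t' y' b" for t' y' b
      using rk_loop_kernel by (simp add: space_prob_algebra)
    show ?thesis
      by (simp add: f_def rk_step_def \<beta>_def F.emeasure_eq_measure measure_rk_loop_set)
  qed
  have H: "has_bochner_integral lborel (\<lambda>y. indicator B y * (max (S y x) 0 / M)) (accept x B)"
    if "B \<in> sets borel" for B
    using accept_integrable[OF that] by (simp only: has_bochner_integral_iff accept_def simp_thms)
  have HP: "has_bochner_integral lborel (\<lambda>y. P y x) 1"
    by (simp add: has_bochner_integral_iff P_integrable P_integral)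
  have UNIV: "UNIV \<in> sets (borel :: real measure)" by simp
  have lim: "has_bochner_integral lborel (\<lambda>y. indicator A y * (max (S y x) 0 / M)
      + (P y x - indicator UNIV y * (max (S y x) 0 / M)) * \<beta>)
      (accept x A + (1 - accept x UNIV) * \<beta>)"
    by (intro has_bochner_integral_add has_bochner_integral_mult_left
        has_bochner_integral_diff H HP A UNIV)
  \<comment> \<open>With \<open>s\<close> the positive part of the kernel, this is the cancellation
    that turns the integrand against the proposal law into the one in \<open>lim\<close>.\<close>
  have arith: "P y x * (s / (M * P y x) * i + (1 - s / (M * P y x)) * \<beta>)
      = i * (s / M) + (P y x - s / M) * \<beta>" for s i y
    using M_pos P_pos[of y x] by (simp add: field_simps)
  have "emeasure (rk_loop S P x N M t Y True) (A \<times> UNIV)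
      = emeasure (U \<bind> (\<lambda>u. D \<bind> (\<lambda>y. f (u, y)))) (A \<times> UNIV)"
    by (simp add: rk_loop_bind[OF t] U_def D_def f_def)
  also have "\<dots> = (\<integral>\<^sup>+u. emeasure (D \<bind> (\<lambda>y. f (u, y))) (A \<times> UNIV) \<partial>U)"
    by (rule emeasure_bind_prob_algebra[OF U _ B])
      (rule measurable_bind_prob_space2[OF measurable_const[OF D]], simp)
  also have "\<dots> = (\<integral>\<^sup>+u. \<integral>\<^sup>+y. emeasure (f (u, y)) (A \<times> UNIV) \<partial>D \<partial>U)"
    by (intro nn_integral_cong emeasure_bind_prob_algebra[OF D _ B]) measurable
  \<comment> \<open>The loop draws \<open>u\<close> before \<open>y\<close>. Swapping puts
    \<open>u\<close> innermost, where the threshold is constant.\<close>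
  also have "\<dots> = (\<integral>\<^sup>+y. \<integral>\<^sup>+u. emeasure (f (u, y)) (A \<times> UNIV) \<partial>U \<partial>D)"
    using measurable_prob_algebraD[OF f]
    by (intro UD.Fubini'[symmetric]) (simp add: split_beta')
  also have "\<dots> = (\<integral>\<^sup>+y. ennreal (max (S y x) 0 / (M * P y x) * indicator A y
      + (1 - max (S y x) 0 / (M * P y x)) * \<beta>) \<partial>D)"
    using density_accept[of _ x] M_pos P_pos[of _ x] \<beta> unfolding inner U_def
    by (intro nn_integral_cong nn_integral_uniform_threshold) (auto simp: field_simps)
  also have "\<dots> = (\<integral>\<^sup>+y. ennreal (P y x) * ennreal (max (S y x) 0 / (M * P y x) * indicator A y
      + (1 - max (S y x) 0 / (M * P y x)) * \<beta>) \<partial>lborel)"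
    unfolding D_def by (subst nn_integral_density) simp_all
  also have "\<dots> = (\<integral>\<^sup>+y. ennreal (indicator A y * (max (S y x) 0 / M)
      + (P y x - indicator UNIV y * (max (S y x) 0 / M)) * \<beta>) \<partial>lborel)"
    using P_pos[of _ x]
    by (intro nn_integral_cong, subst ennreal_mult'[symmetric], simp add: less_imp_le)
      (simp only: arith indicator_UNIV mult_1)
  also have "\<dots> = ennreal (\<integral>y. indicator A y * (max (S y x) 0 / M)
      + (P y x - indicator UNIV y * (max (S y x) 0 / M)) * \<beta> \<partial>lborel)"
    using M_pos density_accept[of _ x] \<beta> lim
    by (intro nn_integral_eq_integral) (auto simp: has_bochner_integral_iff)
  also have "(\<integral>y. indicator A y * (max (S y x) 0 / M)
      + (P y x - indicator UNIV y * (max (S y x) 0 / M)) * \<beta> \<partial>lborel)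
      = accept x A + (1 - accept x UNIV) * \<beta>"
    using lim by (rule has_bochner_integral_integral_eq)
  finally show ?thesis
    unfolding \<beta>_def[symmetric] using \<beta> accept_nonneg[of x A] accept_le_1[of x]
    by (subst measure_eq_emeasure_eq_ennreal) auto
qed

text \<open>The ratio is the fixed point of the affine recursion in
  \<open>measure_rk_loop_step\<close>, so each iteration shrinks the deviation from it by the factor
  \<open>1 - accept x UNIV\<close>. With no iteration left, both numbers lie in [0, 1], whatever the
  default value \<open>Y\<close> is.\<close>

lemma measure_rk_loop_approx:
  assumes A: "A \<in> sets borel" and p: "accept x UNIV > 0"
  shows "\<bar>measure (rk_loop S P x N M t Y True) (A \<times> UNIV) - accept x A / accept x UNIV\<bar>
    \<le> (1 - accept x UNIV) ^ nat \<lceil>N + 1 - real t\<rceil>"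
proof (induction "nat \<lceil>N + 1 - real t\<rceil>" arbitrary: t)
  case 0
  then have "real t \<ge> N + 1" by linarith
  then have "measure (rk_loop S P x N M t Y True) (A \<times> UNIV) = indicator A Y"
    using A by (subst rk_loop.simps) (simp add: measure_return indicator_def)
  moreover have "accept x A / accept x UNIV \<le> 1" "0 \<le> accept x A / accept x UNIV"
    using p accept_mono[OF A, of x] accept_nonneg[of x A] by simp_all
  ultimately show ?case
    using 0 by (auto simp: indicator_def abs_le_iff)
next
  case (Suc k)
  define p where "p = accept x UNIV"
  have t: "real t < N + 1" "k = nat \<lceil>N + 1 - real (t + 1)\<rceil>"
    using Suc(2) by linarith+
  have "measure (rk_loop S P x N M t Y True) (A \<times> UNIV) - accept x A / p
    = (1 - p) * (measure (rk_loop S P x N M (t + 1) Y True) (A \<times> UNIV) - accept x A / p)"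
    unfolding measure_rk_loop_step[OF t(1) A] using assms(2)
    by (simp add: field_simps p_def)
  also have "\<bar>\<dots>\<bar> \<le> (1 - p) * (1 - p) ^ k"
    unfolding abs_mult using Suc(1)[OF t(2)] accept_le_1[of x] t(2)
    by (auto simp: p_def intro!: mult_mono)
  finally show ?case by (simp add: p_def Suc(2)[symmetric])
qed

section \<open>Bound on the iteration counter, and the output law as a kernel\<close>

text \<open>An iteration starts only while \<open>t < N + 1\<close>, so the counter after it is
  below \<open>N + 2\<close>. The flag is arbitrary in the induction because both branches of an
  iteration are needed.\<close>

lemma AE_rk_loop_time:
  assumes "real t \<le> N + 2"
  shows "AE r in rk_loop S P x N M t Y u. real (snd r) \<le> N + 2"
  using assms
proof (induction "nat \<lceil>N + 1 - real t\<rceil>" arbitrary: t Y u rule: less_induct)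
  case less
  show ?case
  proof (cases "\<not> u \<or> real t \<ge> N + 1")
    case True
    then show ?thesis using less(2) by (subst rk_loop.simps) (auto intro!: AE_return[THEN iffD2] simp: space_pair_measure)
  next
    case False
    have IH: "AE r in rk_loop S P x N M (t + 1) Y' u'. real (snd r) \<le> N + 2" for Y' u'
      using False by (intro less(1)) linarith+
    have D: "density lborel (\<lambda>y. ennreal (P y x)) \<in> space (prob_algebra borel)"
      using P_prob[of x] by (auto simp: space_prob_algebra)
    then have [measurable_cong]: "sets (density lborel (\<lambda>y. ennreal (P y x))) = sets borel" by simp
    have inner: "(\<lambda>U. density lborel (\<lambda>y. ennreal (P y x)) \<bind> (\<lambda>y. rk_step t (((x, Y), U), y)))
      \<in> borel \<rightarrow>\<^sub>M prob_algebra out"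
      by (rule measurable_bind_prob_space2[OF measurable_const[OF D]]) measurable
    have step: "AE r in rk_step t (((x, Y), U), y). real (snd r) \<le> N + 2" for U y
      by (cases "U \<le> max (S y x) 0 / (M * P y x)")
        (simp_all only: rk_step_def prod.case if_True if_False IH)
    have m1: "(\<lambda>y. rk_step t (((x, Y), U), y))
      \<in> density lborel (\<lambda>y. ennreal (P y x)) \<rightarrow>\<^sub>M subprob_algebra out" for U
      by (rule measurable_prob_algebraD) measurable
    have m2: "(\<lambda>U. density lborel (\<lambda>y. ennreal (P y x)) \<bind> (\<lambda>y. rk_step t (((x, Y), U), y)))
      \<in> uniform_measure lborel {0..1} \<rightarrow>\<^sub>M subprob_algebra out"
      using measurable_prob_algebraD[OF inner] by (simp cong: measurable_cong_sets)
    have pred: "Measurable.pred out (\<lambda>r. real (snd r) \<le> N + 2)" by measurable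
    have u: "u = True" "real t < N + 1" using False by auto
    show ?thesis
      unfolding u(1) rk_loop_bind[OF u(2)] AE_bind[OF m2 pred] AE_bind[OF m1 pred]
      by (intro AE_I2 step)
  qed
qed

lemma rk_kernel: "(\<lambda>x. rk S P x N M Y) \<in> borel \<rightarrow>\<^sub>M prob_algebra borel"
proof -
  have [measurable]: "(\<lambda>x. rk_loop S P x N M 0 Y True) \<in> borel \<rightarrow>\<^sub>M prob_algebra out"
    using measurable_compose[OF _ rk_loop_measurable, of "\<lambda>x. (x, Y)" borel 0 True] by simp
  show ?thesis unfolding rk_def rk_run_def by measurable
qed

lemma measure_rk_approx:
  assumes A: "A \<in> sets borel" and p: "accept x UNIV > 0"
  shows "\<bar>measure (rk S P x N M Y) A - accept x A / accept x UNIV\<bar>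
    \<le> (1 - accept x UNIV) ^ nat \<lceil>N + 1\<rceil>"
proof -
  have s: "sets (rk_loop S P x N M 0 Y True) = sets out"
    using rk_loop_kernel by (simp add: space_prob_algebra)
  have "measure (rk S P x N M Y) A = measure (rk_loop S P x N M 0 Y True) (A \<times> UNIV)"
    unfolding rk_def rk_run_def using A
    by (subst measure_distr)
      (auto simp: measurable_cong_sets[OF s refl] sets_eq_imp_space_eq[OF s] space_pair_measure
        intro!: arg_cong[where f="measure _"])
  then show ?thesis
    using measure_rk_loop_approx[OF assms, of 0 Y] by simp
qed

lemma AE_rk_run_time: "0 \<le> N + 2 \<Longrightarrow> AE r in rk_run S P x N M Y. real (snd r) \<le> N + 2"
  unfolding rk_run_def by (rule AE_rk_loop_time) simp

end

section \<open>The signed kernel from Laplace to normal location\<close>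

lemma DERIV_normal_density_mean:
  assumes "\<sigma> \<noteq> 0"
  shows "((\<lambda>\<theta>. normal_density \<theta> \<sigma> y) has_real_derivative
    normal_density \<theta> \<sigma> y * ((y - \<theta>) / \<sigma>\<^sup>2)) (at \<theta>)"
proof -
  have "((\<lambda>\<theta>. exp (- (y - \<theta>)\<^sup>2 / (2 * \<sigma>\<^sup>2))) has_real_derivative
      exp (- (y - \<theta>)\<^sup>2 / (2 * \<sigma>\<^sup>2)) * ((y - \<theta>) / \<sigma>\<^sup>2)) (at \<theta>)"
    using assms by (auto intro!: derivative_eq_intros simp: field_simps)
  from DERIV_cmult[OF this, of "1 / sqrt (2 * pi * \<sigma>\<^sup>2)"] show ?thesis
    by (simp add: normal_density_def mult.assoc)
qed

lemma DERIV_normal_density_mean_deriv: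
  assumes "\<sigma> \<noteq> 0"
  shows "((\<lambda>\<theta>. normal_density \<theta> \<sigma> y * ((y - \<theta>) / \<sigma>\<^sup>2)) has_real_derivative
    normal_density \<theta> \<sigma> y * ((y - \<theta>)\<^sup>2 / \<sigma> ^ 4 - 1 / \<sigma>\<^sup>2)) (at \<theta>)"
  using assms
  by (auto intro!: derivative_eq_intros DERIV_normal_density_mean simp: field_simps eval_nat_numeral)

text \<open>Differentiating a normal density twice in its mean multiplies it by a quadratic in
  \<open>y - x\<close>; this closed form underlies every later estimate.\<close>

lemma signed_kernel_normal:
  assumes "\<sigma> \<noteq> 0"
  shows "signed_kernel b (normal_model \<sigma>) y x
    = normal_density x \<sigma> y * (1 + b\<^sup>2 / \<sigma>\<^sup>2 - b\<^sup>2 * (y - x)\<^sup>2 / \<sigma> ^ 4)"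
proof -
  have "deriv (\<lambda>\<theta>. normal_density \<theta> \<sigma> y) = (\<lambda>\<theta>. normal_density \<theta> \<sigma> y * ((y - \<theta>) / \<sigma>\<^sup>2))"
    by (intro ext DERIV_imp_deriv DERIV_normal_density_mean assms)
  then have eq: "(deriv ^^ 2) (\<lambda>\<theta>. normal_model \<sigma> y \<theta>) x
      = normal_density x \<sigma> y * ((y - x)\<^sup>2 / \<sigma> ^ 4 - 1 / \<sigma>\<^sup>2)"
    using DERIV_imp_deriv[OF DERIV_normal_density_mean_deriv[OF assms]]
    by (simp add: normal_model_def numeral_2_eq_2)
  show ?thesis
    unfolding signed_kernel_def eq by (simp add: normal_model_def algebra_simps)
qed

section \<open>The Laplace density is a probability density\<close>

lemma laplace_density_nonneg: "0 < b \<Longrightarrow> 0 \<le> laplace_density \<theta> b x"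
  by (simp add: laplace_density_def)

lemma laplace_density_measurable [measurable]: "laplace_density \<theta> b \<in> borel_measurable borel"
  unfolding laplace_density_def by measurable

lemma
  assumes b_pos: "0 < b"
  shows laplace_density_integrable: "integrable lborel (laplace_density \<theta> b)"
    and laplace_density_integral: "(\<integral>x. laplace_density \<theta> b x \<partial>lborel) = 1"
proof -
  define E where "E = exponential_density (1 / b)"
  have [measurable]: "E \<in> borel_measurable borel"
    unfolding E_def by measurable
  have nonneg: "0 \<le> E x" for x using b_pos by (simp add: E_def exponential_density_def)
  have "emeasure (density lborel E) UNIV = 1"
    using prob_space.emeasure_space_1[OF prob_space_exponential_density[of "1 / b"]] b_pos
    by (simp add: E_def)
  then have E: "has_bochner_integral lborel E 1"
    by (intro has_bochner_integral_nn_integral) (auto simp: emeasure_density nonneg)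
  have 1: "has_bochner_integral lborel (\<lambda>x. E (- \<theta> + 1 * x)) 1"
    using lborel_has_bochner_integral_real_affine_iff[of 1 E 1 "- \<theta>"] E by simp
  have 2: "has_bochner_integral lborel (\<lambda>x. E (\<theta> + (- 1) * x)) 1"
    using lborel_has_bochner_integral_real_affine_iff[of "- 1" E 1 \<theta>] E by simp
  have "has_bochner_integral lborel (\<lambda>x. (E (- \<theta> + 1 * x) + E (\<theta> + (- 1) * x)) / 2) ((1 + 1) / 2)"
    by (intro has_bochner_integral_divide_zero has_bochner_integral_add 1 2)
  moreover have "(1 + 1) / 2 = (1 :: real)" by simp
  ultimately have "has_bochner_integral lborel (\<lambda>x. (E (- \<theta> + 1 * x) + E (\<theta> + (- 1) * x)) / 2) 1"
    by (simp only:)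
  also have "?this \<longleftrightarrow> has_bochner_integral lborel (laplace_density \<theta> b) 1"
  proof (rule has_bochner_integral_cong_AE)
    \<comment> \<open>The Laplace density is the average of an exponential density shifted to
      \<open>\<theta>\<close> and its mirror image. At \<open>\<theta>\<close> itself both halves
      contribute and the average is twice too large, hence equality only almost everywhere.\<close>
    show "AE x in lborel. (E (- \<theta> + 1 * x) + E (\<theta> + (- 1) * x)) / 2 = laplace_density \<theta> b x"
      using AE_lborel_singleton[of \<theta>]
      by eventually_elim (auto simp: E_def exponential_density_def laplace_density_def abs_if diff_divide_distrib)
  qed simp_all
  finally show "integrable lborel (laplace_density \<theta> b)"
    "(\<integral>x. laplace_density \<theta> b x \<partial>lborel) = 1"
    by (auto simp: has_bochner_integral_iff)
qed

lemma prob_space_laplace: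
  assumes "0 < b"
  shows "prob_space (laplace_measure \<theta> b)"
proof
  show "emeasure (laplace_measure \<theta> b) (space (laplace_measure \<theta> b)) = 1"
    using laplace_density_integral[OF assms] laplace_density_integrable[OF assms]
      laplace_density_nonneg[OF assms]
    by (simp add: laplace_measure_def emeasure_density nn_integral_eq_integral)
qed

section \<open>Mass, upper bound and negative part of the signed kernel\<close>

locale laplace_to_normal =
  fixes b \<sigma> :: real
  assumes b_pos: "0 < b" and b_le: "b \<le> \<sigma>"
begin

lemma \<sigma>_pos: "0 < \<sigma>" using b_pos b_le by simp

abbreviation "SK \<equiv> signed_kernel b (normal_model \<sigma>)"

lemma SK_eq: "SK y x = normal_density x \<sigma> y * (1 + b\<^sup>2 / \<sigma>\<^sup>2 - b\<^sup>2 * (y - x)\<^sup>2 / \<sigma> ^ 4)"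
  using \<sigma>_pos by (intro signed_kernel_normal) simp

lemma SK_measurable [measurable]: "case_prod SK \<in> borel_measurable (borel \<Otimes>\<^sub>M borel)"
  unfolding SK_eq normal_density_def split_beta' by measurable

text \<open>The normal variance is \<open>\<sigma>\<^sup>2\<close>, so the two correction terms
  integrate to \<open>b\<^sup>2 / \<sigma>\<^sup>2\<close> each and cancel.\<close>

lemma SK_integrable: "integrable lborel (\<lambda>y. SK y x)"
  and SK_integral: "(\<integral>y. SK y x \<partial>lborel) = 1"
proof -
  have "has_bochner_integral lborel (\<lambda>y. normal_density x \<sigma> y * (y - x) ^ (2 * 1))
      (fact (2 * 1) / ((2 / \<sigma>\<^sup>2) ^ 1 * fact 1))"
    by (rule normal_moment_even[OF \<sigma>_pos])
  then have m: "has_bochner_integral lborel (\<lambda>y. normal_density x \<sigma> y * (y - x)\<^sup>2) (\<sigma>\<^sup>2)"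
    by simp
  have "has_bochner_integral lborel (\<lambda>y. normal_density x \<sigma> y) 1"
    using \<sigma>_pos by (simp add: has_bochner_integral_iff)
  then have "has_bochner_integral lborel
    (\<lambda>y. normal_density x \<sigma> y * (1 + b\<^sup>2 / \<sigma>\<^sup>2) - normal_density x \<sigma> y * (y - x)\<^sup>2 * (b\<^sup>2 / \<sigma> ^ 4))
    (1 * (1 + b\<^sup>2 / \<sigma>\<^sup>2) - \<sigma>\<^sup>2 * (b\<^sup>2 / \<sigma> ^ 4))"
    by (intro has_bochner_integral_diff has_bochner_integral_mult_left m)
  moreover have "1 * (1 + b\<^sup>2 / \<sigma>\<^sup>2) - \<sigma>\<^sup>2 * (b\<^sup>2 / \<sigma> ^ 4) = 1"
    using \<sigma>_pos by (simp add: field_simps eval_nat_numeral)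
  moreover have "normal_density x \<sigma> y * (1 + b\<^sup>2 / \<sigma>\<^sup>2) - normal_density x \<sigma> y * (y - x)\<^sup>2 * (b\<^sup>2 / \<sigma> ^ 4)
      = SK y x" for y
    by (simp add: SK_eq algebra_simps)
  ultimately have "has_bochner_integral lborel (\<lambda>y. SK y x) 1"
    by (simp only:)
  then show "integrable lborel (\<lambda>y. SK y x)" "(\<integral>y. SK y x \<partial>lborel) = 1"
    by (auto simp: has_bochner_integral_iff)
qed

text \<open>The source of M = 2: for \<open>b \<le> \<sigma>\<close> the quadratic factor is at most
  its value at \<open>y = x\<close>, which is at most 2.\<close>

lemma SK_le: "SK y x \<le> 2 * normal_density x \<sigma> y"
proof -
  have "b\<^sup>2 / \<sigma>\<^sup>2 \<le> 1"
    using b_pos b_le by (simp add: power_mono)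
  moreover have "0 \<le> b\<^sup>2 * (y - x)\<^sup>2 / \<sigma> ^ 4" using \<sigma>_pos by simp
  ultimately have "1 + b\<^sup>2 / \<sigma>\<^sup>2 - b\<^sup>2 * (y - x)\<^sup>2 / \<sigma> ^ 4 \<le> 2" by linarith
  from mult_left_mono[OF this, of "normal_density x \<sigma> y"] show ?thesis
    by (simp add: SK_eq mult.commute)
qed

text \<open>In the standardised variable \<open>z\<close>, the kernel is the normal density times
  \<open>- u / r\<^sup>2\<close>, hence negative exactly when \<open>z\<^sup>2\<close> exceeds
  \<open>w\<^sup>2\<close>. The majorant is again a multiple of a normal density, so it integrates
  at once.\<close>

lemma neg_part_le:
  fixes x y
  defines "w \<equiv> sqrt (1 + \<sigma>\<^sup>2 / b\<^sup>2)"
  shows "max (- SK y x) 0 \<le> 6 * exp (- (\<sigma>\<^sup>2 / (2 * b\<^sup>2))) * normal_density x (\<sigma> * w) y"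
proof -
  define r where "r = \<sigma> / b"
  define z where "z = (y - x) / \<sigma>"
  define u where "u = z\<^sup>2 - w\<^sup>2"
  \<comment> \<open>Multiplying the \<open>\<sigma>\<close>-normal density by \<open>exp (l * u)\<close> gives a normal density again, up to a
    factor; this \<open>l\<close> makes \<open>l w\<^sup>2 = r\<^sup>2 / 2\<close>, exactly the exponent wanted, at the price of
    widening the density by \<open>w\<close>.\<close>
  define l where "l = r\<^sup>2 / (2 * w\<^sup>2)"
  have r: "1 \<le> r" using b_pos b_le by (simp add: r_def)
  have w2: "w\<^sup>2 = 1 + r\<^sup>2" by (simp add: w_def r_def power_divide)
  have w: "0 < w" "1 \<le> w" by (auto simp: w_def add_pos_nonneg)
  have l: "0 < l" using r w by (simp add: l_def)
  have r2: "r\<^sup>2 = w\<^sup>2 - 1" using w2 by simp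
  have lu: "l * u = z\<^sup>2 / 2 - (z / w)\<^sup>2 / 2 - r\<^sup>2 / 2"
    using w(1) unfolding l_def u_def r2 by (simp add: power_divide field_simps)
  have eq: "SK y x = normal_density x \<sigma> y * (- u / r\<^sup>2)"
    unfolding SK_eq u_def w2 r_def z_def using \<sigma>_pos b_pos by (simp add: field_simps eval_nat_numeral)
  have e1: "exp (l * u) = exp (z\<^sup>2 / 2) * exp (- ((z / w)\<^sup>2 / 2)) * exp (- (r\<^sup>2 / 2))"
    unfolding lu exp_add[symmetric] by (simp add: algebra_simps)
  have e2: "normal_density x \<sigma> y = exp (- (z\<^sup>2 / 2)) / sqrt (2 * pi * \<sigma>\<^sup>2)"
    by (simp add: normal_density_def z_def power_divide)
  have e3: "normal_density x (\<sigma> * w) y = exp (- ((z / w)\<^sup>2 / 2)) / (w * sqrt (2 * pi * \<sigma>\<^sup>2))"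
    using w(1) by (simp add: normal_density_def z_def power_divide power_mult_distrib
        real_sqrt_mult mult.commute mult.left_commute)
  have nd: "normal_density x \<sigma> y * exp (l * u)
      = w * exp (- (r\<^sup>2 / 2)) * normal_density x (\<sigma> * w) y"
    unfolding e1 e2 e3 using w(1) by (simp add: exp_minus field_simps)
  have "l * u \<le> exp (l * u)"
    using exp_ge_add_one_self[of "l * u"] by linarith
  \<comment> \<open>The exponential Markov bound; for \<open>u \<le> 0\<close> it holds because the
    right side is positive.\<close>
  then have "max u 0 \<le> exp (l * u) / l"
    using l by (simp add: pos_le_divide_eq mult.commute)
  then have "normal_density x \<sigma> y * (max u 0 / r\<^sup>2) \<le> normal_density x \<sigma> y * (exp (l * u) / l / r\<^sup>2)"
    by (intro mult_left_mono divide_right_mono) auto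
  also have "\<dots> = normal_density x \<sigma> y * exp (l * u) * (2 * w\<^sup>2 / r ^ 4)"
    using w(1) r by (simp add: l_def field_simps eval_nat_numeral)
  also have "\<dots> = (2 * w ^ 3 / r ^ 4) * exp (- (r\<^sup>2 / 2)) * normal_density x (\<sigma> * w) y"
    unfolding nd by (simp add: field_simps eval_nat_numeral)
  also have "\<dots> \<le> 6 * exp (- (r\<^sup>2 / 2)) * normal_density x (\<sigma> * w) y"
  proof (intro mult_right_mono)
    \<comment> \<open>Origin of the constant 6: \<open>r \<ge> 1\<close> gives
      \<open>w\<^sup>2 \<le> 2 * r\<^sup>2\<close>, and \<open>8 \<le> 9\<close> makes the cubed
      bound a square, so \<open>w ^ 3 \<le> 3 * r ^ 4\<close>.\<close>
    have "1 \<le> r\<^sup>2" using r by simp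
    then have "(w\<^sup>2) ^ 3 \<le> (2 * r\<^sup>2) ^ 3" by (intro power_mono) (auto simp: w2)
    also have "\<dots> = 8 * (r\<^sup>2) ^ 3 * 1" by (simp add: power_mult_distrib)
    also have "\<dots> \<le> 9 * (r\<^sup>2) ^ 3 * r\<^sup>2"
      using \<open>1 \<le> r\<^sup>2\<close> by (intro mult_mono) auto
    finally have "(w ^ 3)\<^sup>2 \<le> (3 * r ^ 4)\<^sup>2"
      by (simp add: power_mult_distrib power_mult[symmetric] power_add[symmetric] mult.assoc)
    then have "w ^ 3 \<le> 3 * r ^ 4" by (rule power2_le_imp_le) simp
    then show "2 * w ^ 3 / r ^ 4 \<le> 6" using r by (simp add: field_simps)
  qed auto
  finally have *: "normal_density x \<sigma> y * (max u 0 / r\<^sup>2)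
    \<le> 6 * exp (- (r\<^sup>2 / 2)) * normal_density x (\<sigma> * w) y" .
  have max_eq: "max (- SK y x) 0 = normal_density x \<sigma> y * (max u 0 / r\<^sup>2)"
  proof (cases "u \<le> 0")
    case True
    then have "- SK y x \<le> 0" using r unfolding eq by (simp add: mult_nonneg_nonpos divide_nonpos_nonneg)
    with True show ?thesis by simp
  next
    case False
    then have "0 \<le> normal_density x \<sigma> y * (u / r\<^sup>2)" by simp
    with False show ?thesis unfolding eq by simp
  qed
  have "r\<^sup>2 / 2 = \<sigma>\<^sup>2 / (2 * b\<^sup>2)" by (simp add: r_def power_divide)
  with * show ?thesis by (simp only: max_eq)
qed

definition neg_bound :: real where "neg_bound = 6 * exp (- (\<sigma>\<^sup>2 / (2 * b\<^sup>2)))"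

lemma neg_part_integrable: "integrable lborel (\<lambda>y. max (- SK y x) 0)"
  and neg_part_integral: "(\<integral>y. max (- SK y x) 0 \<partial>lborel) \<le> neg_bound"
proof -
  define \<tau> where "\<tau> = \<sigma> * sqrt (1 + \<sigma>\<^sup>2 / b\<^sup>2)"
  have \<tau>: "\<tau> > 0" using \<sigma>_pos by (simp add: \<tau>_def add_pos_nonneg)
  have le: "max (- SK y x) 0 \<le> neg_bound * normal_density x \<tau> y" for y
    using neg_part_le[of y x] by (simp add: neg_bound_def \<tau>_def)
  have int: "integrable lborel (\<lambda>y. neg_bound * normal_density x \<tau> y)" using \<tau> by simp
  show 1: "integrable lborel (\<lambda>y. max (- SK y x) 0)"
    using SK_integrable[of x] by (intro integrable_max) auto
  have "(\<integral>y. max (- SK y x) 0 \<partial>lborel) \<le> (\<integral>y. neg_bound * normal_density x \<tau> y \<partial>lborel)"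
    by (intro integral_mono 1 int le)
  then show "(\<integral>y. max (- SK y x) 0 \<partial>lborel) \<le> neg_bound" using \<tau> by simp
qed

section \<open>The Laplace mixture of the signed kernel is the target normal law\<close>

text \<open>Transfers integrability in \<open>y\<close> to integrability in
  \<open>x\<close>.\<close>

lemma SK_commute: "SK y x = SK x y"
  by (simp add: SK_eq normal_density_def power2_commute)

lemma laplace_SK_integrable: "integrable lborel (\<lambda>x. laplace_density \<theta> b x * SK y x)"
proof (rule Bochner_Integration.integrable_bound)
  show "integrable lborel (\<lambda>x. 1 / (2 * b) * SK x y)"
    using SK_integrable by simp
  show "AE x in lborel. norm (laplace_density \<theta> b x * SK y x) \<le> norm (1 / (2 * b) * SK x y)"
    using b_pos by (auto simp: laplace_density_def abs_mult SK_commute[of y] intro!: divide_right_mono mult_left_le_one_le)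
qed measurable

text \<open>The fundamental theorem of calculus is applied on each side of the kink at
  \<open>\<theta>\<close>. The antiderivatives vanish at infinity, so only their values at the kink
  survive.\<close>

lemma laplace_SK_integral: "(\<integral>x. laplace_density \<theta> b x * SK y x \<partial>lborel) = normal_density \<theta> \<sigma> y"
proof -
  define v where "v = (\<lambda>x. normal_density x \<sigma> y)"
  define v' where "v' = (\<lambda>x. v x * ((y - x) / \<sigma>\<^sup>2))"
  define f where "f = (\<lambda>x. laplace_density \<theta> b x * SK y x)"
  \<comment> \<open>\<open>F 1\<close> and \<open>F (- 1)\<close> are antiderivatives of \<open>f\<close> to the right and to the left of the kink \<open>\<theta>\<close>;
    the \<open>v'\<close> terms cancel in \<open>F (- 1) \<theta> - F 1 \<theta>\<close>.\<close>
  define F where "F = (\<lambda>s x. exp (- s * (x - \<theta>) / b) / (2 * b) * (- s * b * v x - b\<^sup>2 * v' x))"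
  have v: "(v has_real_derivative v' x) (at x)" for x
    using DERIV_normal_density_mean[of \<sigma> y x] \<sigma>_pos by (simp add: v_def v'_def)
  have v': "(v' has_real_derivative (v x - SK y x) / b\<^sup>2) (at x)" for x
  proof -
    have "(v x - SK y x) / b\<^sup>2 = normal_density x \<sigma> y * ((y - x)\<^sup>2 / \<sigma> ^ 4 - 1 / \<sigma>\<^sup>2)"
      using b_pos by (simp add: v_def SK_eq field_simps)
    then show ?thesis
      using DERIV_normal_density_mean_deriv[of \<sigma> y x] \<sigma>_pos by (simp add: v_def v'_def)
  qed
  \<comment> \<open>Since \<open>s * s = 1\<close>, the product rule cancels all terms in
    \<open>v\<close> and \<open>v'\<close> and leaves only the kernel.\<close>
  have F: "(F s has_real_derivative exp (- s * (x - \<theta>) / b) / (2 * b) * SK y x) (at x)"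
    if "s = 1 \<or> s = -1" for s x
    using that b_pos unfolding F_def
    by (auto intro!: derivative_eq_intros v v' simp: field_simps power2_eq_square)
  have "isCont (\<lambda>x. SK y x) x" for x
    unfolding SK_eq normal_density_def using \<sigma>_pos by (auto intro!: continuous_intros)
  then have cont: "isCont f x" for x
    unfolding f_def laplace_density_def using b_pos by (auto intro!: continuous_intros)
  have contF: "isCont (F s) \<theta>" if "s = 1 \<or> s = -1" for s
    using F[OF that] by (rule DERIV_isCont)
  have int: "integrable lborel f" unfolding f_def by (rule laplace_SK_integrable)
  then have set_int: "set_integrable lborel A f" if "A \<in> sets borel" for A
    unfolding set_integrable_def using that by (intro integrable_mult_indicator) auto
  have Fv: "(F 1 has_vector_derivative f x) (at x)" if "\<theta> < x" for x
    using F[of 1 x] that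
    by (simp add: f_def laplace_density_def has_real_derivative_iff_has_vector_derivative
        diff_divide_distrib)
  have Fv': "(F (- 1) has_vector_derivative f x) (at x)" if "x < \<theta>" for x
    using F[of "- 1" x] that
    by (simp add: f_def laplace_density_def has_real_derivative_iff_has_vector_derivative
        diff_divide_distrib)
  have "(LBINT x=ereal \<theta>..\<infinity>. f x) = 0 - F 1 \<theta>"
  proof (rule interval_integral_FTC_integrable)
    show "((F 1 \<circ> real_of_ereal) \<longlongrightarrow> F 1 \<theta>) (at_right (ereal \<theta>))"
      using contF[of 1] by (auto simp: ereal_tendsto_simps1 isCont_def intro: tendsto_within_subset)
    show "((F 1 \<circ> real_of_ereal) \<longlongrightarrow> 0) (at_left \<infinity>)"
      unfolding ereal_tendsto_simps1 F_def v'_def v_def normal_density_def using \<sigma>_pos b_pos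
      by real_asymp
  qed (auto intro: cont set_int Fv)
  moreover have "(LBINT x=-\<infinity>..ereal \<theta>. f x) = F (-1) \<theta> - 0"
  proof (rule interval_integral_FTC_integrable)
    show "((F (-1) \<circ> real_of_ereal) \<longlongrightarrow> F (-1) \<theta>) (at_left (ereal \<theta>))"
      using contF[of "-1"] by (auto simp: ereal_tendsto_simps1 isCont_def intro: tendsto_within_subset)
    show "((F (-1) \<circ> real_of_ereal) \<longlongrightarrow> 0) (at_right (-\<infinity>))"
      unfolding ereal_tendsto_simps1 F_def v'_def v_def normal_density_def using \<sigma>_pos b_pos
      by real_asymp
  qed (auto intro: cont set_int Fv')
  moreover have "(LBINT x=-\<infinity>..ereal \<theta>. f x) + (LBINT x=ereal \<theta>..\<infinity>. f x) = (LBINT x=-\<infinity>..\<infinity>. f x)"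
    using int by (intro interval_integral_sum) (simp add: interval_lebesgue_integrable_def set_integrable_def)
  moreover have "(LBINT x=-\<infinity>..\<infinity>. f x) = (\<integral>x. f x \<partial>lborel)"
    by (simp add: interval_lebesgue_integral_def set_lebesgue_integral_def)
  moreover have "F (-1) \<theta> - F 1 \<theta> = v \<theta>" using b_pos by (simp add: F_def field_simps)
  ultimately show ?thesis by (simp add: f_def v_def)
qed

text \<open>The bound on the L1 norm is uniform in \<open>x\<close>, as the Fubini argument
  requires.\<close>

lemma abs_SK_integrable: "integrable lborel (\<lambda>y. \<bar>SK y x\<bar>)"
  and abs_SK_integral: "(\<integral>y. \<bar>SK y x\<bar> \<partial>lborel) \<le> 1 + 2 * neg_bound"
proof -
  have eq: "\<bar>SK y x\<bar> = SK y x + 2 * max (- SK y x) 0" for y by auto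
  show "integrable lborel (\<lambda>y. \<bar>SK y x\<bar>)"
    using SK_integrable by simp
  have "(\<integral>y. \<bar>SK y x\<bar> \<partial>lborel) = 1 + 2 * (\<integral>y. max (- SK y x) 0 \<partial>lborel)"
    unfolding eq by (subst Bochner_Integration.integral_add)
      (auto intro: SK_integrable neg_part_integrable simp: SK_integral)
  then show "(\<integral>y. \<bar>SK y x\<bar> \<partial>lborel) \<le> 1 + 2 * neg_bound"
    using neg_part_integral[of x] by simp
qed

lemma set_SK_integrable: "A \<in> sets borel \<Longrightarrow> integrable lborel (\<lambda>y. indicator A y * SK y x)"
  using integrable_mult_indicator[OF _ SK_integrable[of x], of A] by simp

text \<open>Once the integrals are swapped, the one over \<open>x\<close> is the Green's function
  identity \<open>laplace_SK_integral\<close>.\<close>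

lemma laplace_SK_Fubini:
  assumes A [measurable]: "A \<in> sets borel"
  shows "(\<integral>x. laplace_density \<theta> b x * (\<integral>y. indicator A y * SK y x \<partial>lborel) \<partial>lborel)
    = measure (normal_measure \<theta> \<sigma>) A"
proof -
  define f where "f = (\<lambda>(x, y). laplace_density \<theta> b x * (indicator A y * SK y x))"
  have [measurable]: "(\<lambda>z. SK (snd z) (fst z)) \<in> borel_measurable (borel \<Otimes>\<^sub>M borel)"
    using measurable_compose[OF measurable_pair_swap' SK_measurable] by (simp add: split_beta')
  have [measurable]: "(\<lambda>z. SK (snd z) (fst z)) \<in> borel_measurable (lborel \<Otimes>\<^sub>M lborel)"
    by (simp cong: measurable_cong_sets)
  have f [measurable]: "f \<in> borel_measurable (lborel \<Otimes>\<^sub>M lborel)"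
    unfolding f_def split_beta' by measurable
  have int: "integrable (lborel \<Otimes>\<^sub>M lborel) f"
  proof (rule lborel_pair.Fubini_integrable[OF f])
    show "integrable lborel (\<lambda>x. \<integral>y. norm (f (x, y)) \<partial>lborel)"
    proof (rule Bochner_Integration.integrable_bound)
      show "integrable lborel (\<lambda>x. laplace_density \<theta> b x * (1 + 2 * neg_bound))"
        using laplace_density_integrable[OF b_pos] by simp
      show "AE x in lborel. norm (\<integral>y. norm (f (x, y)) \<partial>lborel) \<le> norm (laplace_density \<theta> b x * (1 + 2 * neg_bound))"
      proof (intro AE_I2)
        fix x :: real
        have "(\<integral>y. norm (f (x, y)) \<partial>lborel) = laplace_density \<theta> b x * (\<integral>y. \<bar>indicator A y * SK y x\<bar> \<partial>lborel)"
          using laplace_density_nonneg[OF b_pos, of \<theta> x] by (simp add: f_def abs_mult)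
        also have "(\<integral>y. \<bar>indicator A y * SK y x\<bar> \<partial>lborel) \<le> (\<integral>y. \<bar>SK y x\<bar> \<partial>lborel)"
          by (intro integral_mono integrable_abs abs_SK_integrable set_SK_integrable A) (auto simp: indicator_def)
        also note abs_SK_integral
        finally have "(\<integral>y. norm (f (x, y)) \<partial>lborel) \<le> laplace_density \<theta> b x * (1 + 2 * neg_bound)"
          using laplace_density_nonneg[OF b_pos, of \<theta> x] by (simp add: mult_left_mono)
        then show "norm (\<integral>y. norm (f (x, y)) \<partial>lborel) \<le> norm (laplace_density \<theta> b x * (1 + 2 * neg_bound))"
          by simp
      qed
    qed measurable
    show "AE x in lborel. integrable lborel (\<lambda>y. f (x, y))"
      unfolding f_def using set_SK_integrable[OF A] by simp
  qed
  have "(\<integral>x. laplace_density \<theta> b x * (\<integral>y. indicator A y * SK y x \<partial>lborel) \<partial>lborel)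
    = (\<integral>x. (\<integral>y. f (x, y) \<partial>lborel) \<partial>lborel)"
    by (simp add: f_def)
  also have "\<dots> = (\<integral>y. (\<integral>x. f (x, y) \<partial>lborel) \<partial>lborel)"
    using lborel_pair.Fubini_integral[of "\<lambda>x y. f (x, y)"] int by simp
  also have "\<dots> = (\<integral>y. indicator A y * normal_density \<theta> \<sigma> y \<partial>lborel)"
    unfolding laplace_SK_integral[symmetric] by (simp add: f_def mult.left_commute)
  also have "\<dots> = measure (normal_measure \<theta> \<sigma>) A"
  proof -
    have "integrable lborel (\<lambda>y. indicator A y * normal_density \<theta> \<sigma> y)"
      using integrable_mult_indicator[OF _ integrable_normal_density[OF \<sigma>_pos], of A \<theta>] by simp
    then have "emeasure (normal_measure \<theta> \<sigma>) A = ennreal (\<integral>y. indicator A y * normal_density \<theta> \<sigma> y \<partial>lborel)"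
      unfolding normal_measure_def
      by (subst nn_integral_eq_integral[symmetric])
        (auto simp: emeasure_density ennreal_mult'' mult.commute ennreal_indicator intro!: nn_integral_cong)
    then show ?thesis
      by (subst measure_eq_emeasure_eq_ennreal) (auto intro!: integral_nonneg_AE)
  qed
  finally show ?thesis .
qed

section \<open>Error of the sampler for fixed input, then averaged over the Laplace input\<close>

sublocale rejection_kernel "signed_kernel b (normal_model \<sigma>)" "\<lambda>y x. normal_density x \<sigma> y" N 2 for N
proof (rule rejection_kernel.intro)
  have [simp]: "0 < \<sigma>" using b_pos b_le by simp
  show "case_prod (signed_kernel b (normal_model \<sigma>)) \<in> borel_measurable (borel \<Otimes>\<^sub>M borel)"
    by (rule SK_measurable)
  show "(\<lambda>(y, x). normal_density x \<sigma> y) \<in> borel_measurable (borel \<Otimes>\<^sub>M borel)"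
    unfolding normal_density_def by measurable
  show "signed_kernel b (normal_model \<sigma>) y x \<le> 2 * normal_density x \<sigma> y" for y x
    by (rule SK_le)
  show "0 < normal_density x \<sigma> y" for y x
    by (rule normal_density_pos) simp
  show "prob_space (density lborel (\<lambda>y. ennreal (normal_density x \<sigma> y)))" for x
    by (rule prob_space_normal_density) simp
qed simp

text \<open>Here \<open>s\<close> and \<open>n\<close> are the integrals over \<open>A\<close> of
  the positive and the negative part of the kernel; the factor 1/2 is 1/M.\<close>

lemma accept_SK:
  assumes A [measurable]: "A \<in> sets borel"
  obtains s n where "accept x A = s / 2" "(\<integral>y. indicator A y * SK y x \<partial>lborel) = s - n"
     "0 \<le> n" "n \<le> (\<integral>y. max (- SK y x) 0 \<partial>lborel)"
proof
  let ?s = "\<integral>y. indicator A y * max (SK y x) 0 \<partial>lborel"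
  let ?n = "\<integral>y. indicator A y * max (- SK y x) 0 \<partial>lborel"
  have SK [simp]: "integrable lborel (\<lambda>y. SK y x)" by (rule SK_integrable)
  have int: "integrable lborel (\<lambda>y. indicator A y * max (SK y x) 0)"
    "integrable lborel (\<lambda>y. indicator A y * max (- SK y x) 0)"
    using integrable_mult_indicator[of A lborel "\<lambda>y. max (SK y x) 0"]
       integrable_mult_indicator[of A lborel "\<lambda>y. max (- SK y x) 0"] by auto
  show "accept x A = ?s / 2"
    unfolding accept_def by (simp flip: integral_divide_zero)
  have "(\<integral>y. indicator A y * SK y x \<partial>lborel)
    = (\<integral>y. indicator A y * max (SK y x) 0 - indicator A y * max (- SK y x) 0 \<partial>lborel)"
    by (intro Bochner_Integration.integral_cong) (auto simp: max_def)
  then show "(\<integral>y. indicator A y * SK y x \<partial>lborel) = ?s - ?n"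
    using int by simp
  show "0 \<le> ?n" by (intro integral_nonneg_AE) auto
  show "?n \<le> (\<integral>y. max (- SK y x) 0 \<partial>lborel)"
    using int by (intro integral_mono) (auto simp: indicator_def)
qed

text \<open>The positive part is the kernel plus its negative part, and the kernel has mass 1. Hence
  the acceptance probability is at least 1/2.\<close>

lemma accept_UNIV: "accept x UNIV = (1 + (\<integral>y. max (- SK y x) 0 \<partial>lborel)) / 2"
proof -
  have "(\<integral>y. max (SK y x) 0 \<partial>lborel) = (\<integral>y. SK y x + max (- SK y x) 0 \<partial>lborel)"
    by (intro Bochner_Integration.integral_cong) auto
  also have "\<dots> = 1 + (\<integral>y. max (- SK y x) 0 \<partial>lborel)"
    using SK_integrable[of x] SK_integral[of x] by simp
  finally show ?thesis by (simp add: accept_def)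
qed

lemma rk_approx_signed_kernel:
  assumes A: "A \<in> sets borel"
  shows "\<bar>measure (rk SK (\<lambda>y x. normal_density x \<sigma> y) x N 2 Y) A - (\<integral>y. indicator A y * SK y x \<partial>lborel)\<bar>
    \<le> (1 / 2) ^ nat \<lceil>N + 1\<rceil> + (\<integral>y. max (- SK y x) 0 \<partial>lborel)"
proof -
  obtain s n where sn: "accept x A = s / 2" "(\<integral>y. indicator A y * SK y x \<partial>lborel) = s - n"
     "0 \<le> n" "n \<le> (\<integral>y. max (- SK y x) 0 \<partial>lborel)"
    using accept_SK[OF A] .
  define q where "q = (\<integral>y. max (- SK y x) 0 \<partial>lborel)"
  have q: "0 \<le> q" using sn(3,4) by (simp add: q_def)
  have p: "accept x UNIV = (1 + q) / 2" by (simp add: accept_UNIV q_def)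
  have s: "0 \<le> s" "s \<le> 1 + q"
    using accept_nonneg[of x A] accept_mono[OF A, of x] by (simp_all add: sn p)
  have "\<bar>measure (rk SK (\<lambda>y x. normal_density x \<sigma> y) x N 2 Y) A - accept x A / accept x UNIV\<bar>
      \<le> (1 - accept x UNIV) ^ nat \<lceil>N + 1\<rceil>"
    using q by (intro measure_rk_approx A) (simp add: p)
  also have "\<dots> \<le> (1 / 2) ^ nat \<lceil>N + 1\<rceil>"
    using accept_le_1[of x] q by (intro power_mono) (auto simp: p)
  finally have 1: "\<bar>measure (rk SK (\<lambda>y x. normal_density x \<sigma> y) x N 2 Y) A - s / (1 + q)\<bar>
      \<le> (1 / 2) ^ nat \<lceil>N + 1\<rceil>"
    by (simp add: sn p)
  \<comment> \<open>Both \<open>s / (1 + q)\<close> and \<open>s - n\<close> lie between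
    \<open>s - q\<close> and \<open>s\<close>, so normalising and dropping the negative part cost
    \<open>q\<close> together, not \<open>2 * q\<close>.\<close>
  have "s - s / (1 + q) = s * q / (1 + q)" using q by (simp add: field_simps)
  moreover have "s * q / (1 + q) \<le> q" "0 \<le> s * q / (1 + q)"
    using s q mult_right_mono[OF s(2) q] by (simp_all add: field_simps)
  ultimately have "\<bar>s / (1 + q) - (s - n)\<bar> \<le> q"
    using sn(3,4) unfolding q_def[symmetric] by linarith
  with 1 show ?thesis unfolding sn(2) q_def[symmetric] by linarith
qed

text \<open>The target is the Laplace mixture of the signed kernel and the output law is the Laplace
  mixture of the sampler, so the error bound for fixed input, uniform in \<open>x\<close> and
  \<open>A\<close>, carries over.\<close>

lemma tv_dist_rk_laplace_normal_le:
  "tv_dist (rk_laplace_normal b \<sigma> \<theta> N 2 Y) (normal_measure \<theta> \<sigma>)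
    \<le> (1 / 2) ^ nat \<lceil>N + 1\<rceil> + 6 * exp (- (\<sigma>\<^sup>2 / (2 * b\<^sup>2)))"
proof -
  define L where "L = laplace_measure \<theta> b"
  define K where "K = (\<lambda>x. rk SK (\<lambda>y x. normal_density x \<sigma> y) x N 2 Y)"
  define \<delta> where "\<delta> = (1 / 2) ^ nat \<lceil>N + 1\<rceil> + 6 * exp (- (\<sigma>\<^sup>2 / (2 * b\<^sup>2)))"
  interpret L: prob_space L
    unfolding L_def by (rule prob_space_laplace[OF b_pos])
  have [measurable_cong]: "sets L = sets borel" by (simp add: L_def laplace_measure_def)
  have L: "L \<in> space (prob_algebra borel)"
    using L.prob_space_axioms by (simp add: space_prob_algebra L_def laplace_measure_def)
  have K: "K \<in> borel \<rightarrow>\<^sub>M prob_algebra borel"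
    unfolding K_def by (rule rk_kernel)
  have rk: "rk_laplace_normal b \<sigma> \<theta> N 2 Y = L \<bind> K"
    by (simp add: rk_laplace_normal_def L_def K_def)
  have sets: "sets (L \<bind> K) = sets borel"
    by (rule sets_bind'[OF L K])
  have "\<bar>measure (L \<bind> K) A - measure (normal_measure \<theta> \<sigma>) A\<bar> \<le> \<delta>" if A [measurable]: "A \<in> sets borel" for A
  proof -
    define G where "G = (\<lambda>x. \<integral>y. indicator A y * SK y x \<partial>lborel)"
    have [measurable]: "G \<in> borel_measurable borel"
      unfolding G_def by measurable
    have [measurable]: "(\<lambda>x. measure (K x) A) \<in> borel_measurable borel"
      using K by measurable
    have le: "\<bar>measure (K x) A - G x\<bar> \<le> \<delta>" for x
      using rk_approx_signed_kernel[OF A, of x N Y] neg_part_integral[of x]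
      by (simp add: K_def G_def \<delta>_def neg_bound_def)
    have K1: "measure (K x) A \<le> 1" for x
      using measurable_space[OF K, of x] by (auto simp: space_prob_algebra intro: prob_space.prob_le_1)
    \<comment> \<open>\<open>G x\<close> is within \<open>\<delta>\<close> of a probability; this
      boundedness yields integrability.\<close>
    have "\<bar>G x\<bar> \<le> 1 + \<delta>" for x
      using le[of x] K1[of x] measure_nonneg[of "K x" A] by linarith
    then have intG: "integrable L G"
      by (intro L.integrable_const_bound[where B="1 + \<delta>"]) auto
    have intK: "integrable L (\<lambda>x. measure (K x) A)"
      using K1 by (intro L.integrable_const_bound[where B=1]) auto
    have "measure (L \<bind> K) A = (\<integral>x. measure (K x) A \<partial>L)"
      using measurable_prob_algebraD[OF K] by (intro L.measure_bind[where N=borel]) auto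
    moreover have "measure (normal_measure \<theta> \<sigma>) A = (\<integral>x. G x \<partial>L)"
      unfolding laplace_SK_Fubini[OF A, symmetric] L_def laplace_measure_def
      using laplace_density_nonneg[OF b_pos]
      by (subst integral_density) (auto simp: G_def)
    ultimately have "measure (L \<bind> K) A - measure (normal_measure \<theta> \<sigma>) A
        = (\<integral>x. measure (K x) A - G x \<partial>L)"
      using intG intK by simp
    also have "\<bar>\<dots>\<bar> \<le> (\<integral>x. \<bar>measure (K x) A - G x\<bar> \<partial>L)"
      by (rule integral_abs_bound)
    also have "\<dots> \<le> (\<integral>x. \<delta> \<partial>L)"
      using intG intK le by (intro integral_mono) auto
    finally show ?thesis by (simp add: L.prob_space)
  qed
  then show ?thesis
    unfolding tv_dist_def rk sets \<delta>_def[symmetric] by (intro cSUP_least) auto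
qed

lemma AE_rk_run_steps_le:
  "0 \<le> N \<Longrightarrow> AE r in rk_run SK (\<lambda>y x. normal_density x \<sigma> y) x N 2 Y. real (snd r) \<le> N + 2"
  by (rule AE_rk_run_time) simp

end

section \<open>Choice of N and of the constants in the final bounds\<close>

text \<open>Since e is at most 4, \<open>exp (1 / 2) \<le> 2\<close>, so \<open>2 ^ k\<close> is at
  least \<open>exp (k / 2)\<close>, which is at least \<open>4 / \<epsilon>\<close>.\<close>

lemma half_power_le:
  assumes \<epsilon>: "0 < \<epsilon>" "\<epsilon> < 1" and N: "2 * ln (4 / \<epsilon>) \<le> N"
  shows "(1 / 2 :: real) ^ nat \<lceil>N + 1\<rceil> \<le> \<epsilon> / 2"
proof -
  define k where "k = nat \<lceil>N + 1\<rceil>"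
  have "exp (1 / 2 :: real) ^ 2 = exp 1"
    unfolding power2_eq_square mult_exp_exp by simp
  then have "exp (1 / 2 :: real) ^ 2 \<le> 2 ^ 2" using exp_le by simp
  then have e: "exp (1 / 2 :: real) \<le> 2" by (rule power2_le_imp_le) simp
  have "2 * ln (4 / \<epsilon>) \<le> real k" using N unfolding k_def by linarith
  then have "exp (ln (4 / \<epsilon>)) \<le> exp (real k * (1 / 2))" by simp
  then have "4 / \<epsilon> \<le> exp (real k * (1 / 2))" using \<epsilon> by simp
  also have "\<dots> = exp (1 / 2) ^ k" by (rule exp_of_nat_mult)
  also have "\<dots> \<le> 2 ^ k" by (intro power_mono e) simp
  finally have "(1 / 2) ^ k \<le> \<epsilon> / 4"
    using \<epsilon> by (simp add: power_one_over field_simps)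
  then show ?thesis using \<epsilon> by (simp add: k_def)
qed

text \<open>Lets the additive 2 in the iteration bound be absorbed into a multiple of the
  logarithm.\<close>

lemma ln_4_div_ge_1:
  assumes "0 < \<epsilon>" "\<epsilon> < 1" shows "1 \<le> ln (4 / \<epsilon> :: real)"
proof -
  have "exp 1 \<le> (3 :: real)" by (rule exp_le)
  also have "3 \<le> 4 / \<epsilon>" using assms by (simp add: field_simps)
  finally show ?thesis using assms by (simp add: ln_ge_iff)
qed

theorem theorem1:
  shows
    "(\<forall>(b::real) (\<sigma>::real) (\<epsilon>::real) (\<theta>::real) (N::real) (y\<^sub>0::real).
        0 < b \<longrightarrow> b \<le> \<sigma> \<longrightarrow> 0 < \<epsilon> \<longrightarrow> \<epsilon> < 1 \<longrightarrow> 2 * ln (4 / \<epsilon>) \<le> N \<longrightarrow>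
        tv_dist (rk_laplace_normal b \<sigma> \<theta> N 2 y\<^sub>0) (normal_measure \<theta> \<sigma>)
          \<le> \<epsilon> / 2 + 6 * exp (- (\<sigma>\<^sup>2 / (2 * b\<^sup>2))))
     \<and>
     (\<forall>c::real. 0 \<le> c \<longrightarrow> (\<exists>K::real. \<forall>(b::real) (\<sigma>::real) (\<epsilon>::real) (y\<^sub>0::real) (\<Theta>::real set)
          (T_samp::real) (T_eval::real).
        0 < b \<longrightarrow> b \<le> \<sigma> \<longrightarrow> 0 < \<epsilon> \<longrightarrow> \<epsilon> < 1 \<longrightarrow> 2 * b\<^sup>2 * ln (12 / \<epsilon>) \<le> \<sigma>\<^sup>2 \<longrightarrow>
        0 \<le> T_samp \<longrightarrow> 0 \<le> T_eval \<longrightarrow> 1 \<le> T_samp + T_eval \<longrightarrow>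
        (\<forall>x::real. AE r in rk_run (signed_kernel b (normal_model \<sigma>))
              (\<lambda>y x. normal_density x \<sigma> y) x (2 * ln (4 / \<epsilon>)) 2 y\<^sub>0.
            rk_time T_samp T_eval c (snd r) \<le> K * (ln (4 / \<epsilon>) * (T_samp + T_eval)))
        \<and> (SUP \<theta>\<in>\<Theta>. ereal (tv_dist (rk_laplace_normal b \<sigma> \<theta> (2 * ln (4 / \<epsilon>)) 2 y\<^sub>0)
              (normal_measure \<theta> \<sigma>))) \<le> ereal \<epsilon>))"
proof -
  have tv: "tv_dist (rk_laplace_normal b \<sigma> \<theta> N 2 y\<^sub>0) (normal_measure \<theta> \<sigma>)
      \<le> \<epsilon> / 2 + 6 * exp (- (\<sigma>\<^sup>2 / (2 * b\<^sup>2)))"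
    if "0 < b" "b \<le> \<sigma>" "0 < \<epsilon>" "\<epsilon> < 1" "2 * ln (4 / \<epsilon>) \<le> N" for b \<sigma> \<epsilon> \<theta> N y\<^sub>0 :: real
    using laplace_to_normal.tv_dist_rk_laplace_normal_le[OF laplace_to_normal.intro[OF that(1,2)],
        of \<theta> N y\<^sub>0] half_power_le[OF that(3-5)]
    by simp
  have time: "AE r in rk_run (signed_kernel b (normal_model \<sigma>)) (\<lambda>y x. normal_density x \<sigma> y)
        x (2 * ln (4 / \<epsilon>)) 2 y\<^sub>0.
      rk_time T_samp T_eval c (snd r) \<le> 4 * (1 + c) * (ln (4 / \<epsilon>) * (T_samp + T_eval))"
    if c: "0 \<le> c" and "0 < b" "b \<le> \<sigma>" "0 < \<epsilon>" "\<epsilon> < 1"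
      and T: "1 \<le> T_samp + T_eval" for b \<sigma> \<epsilon> c x y\<^sub>0 T_samp T_eval :: real
  proof -
    define l where "l = ln (4 / \<epsilon>)"
    have l: "1 \<le> l" unfolding l_def by (rule ln_4_div_ge_1[OF that(4,5)])
    have "AE r in rk_run (signed_kernel b (normal_model \<sigma>)) (\<lambda>y x. normal_density x \<sigma> y)
        x (2 * l) 2 y\<^sub>0. real (snd r) \<le> 2 * l + 2"
      using l by (intro laplace_to_normal.AE_rk_run_steps_le laplace_to_normal.intro that(2,3)) simp
    then show ?thesis unfolding l_def[symmetric]
    proof eventually_elim
      case (elim r)
      \<comment> \<open>The total sampling and evaluation cost is at least 1, so it absorbs the
        overhead \<open>c\<close>. The factor 4 comes from
        \<open>2 * l + 2 \<le> 4 * l\<close>.\<close>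
      have "T_samp + T_eval + c \<le> (1 + c) * (T_samp + T_eval)"
        using mult_left_mono[OF T c] by (simp add: algebra_simps)
      moreover have "real (snd r) \<le> 4 * l" using elim l by simp
      ultimately have "real (snd r) * (T_samp + T_eval + c) \<le> (4 * l) * ((1 + c) * (T_samp + T_eval))"
        using c T l by (intro mult_mono) auto
      then show ?case by (simp add: rk_time_def algebra_simps)
    qed
  qed
  have sup: "(SUP \<theta>\<in>\<Theta>. ereal (tv_dist (rk_laplace_normal b \<sigma> \<theta> (2 * ln (4 / \<epsilon>)) 2 y\<^sub>0)
              (normal_measure \<theta> \<sigma>))) \<le> ereal \<epsilon>"
    if "0 < b" "b \<le> \<sigma>" "0 < \<epsilon>" "\<epsilon> < 1" and \<sigma>: "2 * b\<^sup>2 * ln (12 / \<epsilon>) \<le> \<sigma>\<^sup>2"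
    for b \<sigma> \<epsilon> y\<^sub>0 :: real and \<Theta>
  proof (rule SUP_least)
    fix \<theta> assume "\<theta> \<in> \<Theta>"
    \<comment> \<open>The 12 makes the Gaussian tail term at most
      \<open>6 * (\<epsilon> / 12)\<close>, the remaining half of \<open>\<epsilon>\<close>.\<close>
    have "ln (12 / \<epsilon>) \<le> \<sigma>\<^sup>2 / (2 * b\<^sup>2)" using \<sigma> that(1) by (simp add: field_simps)
    then have "exp (- (\<sigma>\<^sup>2 / (2 * b\<^sup>2))) \<le> exp (- ln (12 / \<epsilon>))" by simp
    also have "\<dots> = \<epsilon> / 12" using that(3) by (simp add: exp_minus)
    finally show "ereal (tv_dist (rk_laplace_normal b \<sigma> \<theta> (2 * ln (4 / \<epsilon>)) 2 y\<^sub>0)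
              (normal_measure \<theta> \<sigma>)) \<le> ereal \<epsilon>"
      using tv[OF that(1-4) order_refl, of \<theta> y\<^sub>0] by simp
  qed
  show ?thesis
  proof (intro conjI allI impI, goal_cases)
    case (1 b \<sigma> \<epsilon> \<theta> N y\<^sub>0)
    show ?case by (rule tv[OF 1])
  next
    case (2 c)
    note c = this
    show ?case
    \<comment> \<open>The witness depends on the overhead \<open>c\<close> alone, so the implied
      constant is uniform in all model parameters.\<close>
    proof (rule exI[of _ "4 * (1 + c)"], intro allI impI conjI, goal_cases)
      case (1 b \<sigma> \<epsilon> y\<^sub>0 \<Theta> T_samp T_eval x)
      show ?case by (rule time[OF c 1(1-4,8)])
    next
      case (2 b \<sigma> \<epsilon> y\<^sub>0 \<Theta> T_samp T_eval)
      show ?case by (rule sup[OF 2(1-5)])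
    qed
  qed
qed

end
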